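(* Let $b_n\ge1$ ($n\ge1$) be odd integers and, for $p\in[0,1]$, let $\widetilde T^p_{b_1,b_2,\dots}=\inf\{n\ge1:|V_n^p|\ge b_n\}$. Then $\widetilde T^p_{b_1,b_2,\dots}$ is stochastically increasing in $p\in[0,\frac12]$ and stochastically decreasing in $p\in[\frac12,1]$.
   Context: For $p\in[0,1]$, let $X_1^p,X_2^p,\dots$ be i.i.d. with $P(X_n^p=1)=p$ and $P(X_n^p=-1)=1-p$, and let $X_0\in\{+1,-1\}$ be independent of $X_1^p,X_2^p,\dots$ with $P(X_0=1)=P(X_0=-1)=\frac12$. Set $V_0^p=X_0$ and $V_n^p=X_0+2X_1^p+\cdots+2X_n^p$ for $n\ge1$. Convention: $\inf\emptyset=\infty$. A family of $\{1,2,\dots\}\cup\{\infty\}$-valued random variables $T^p$ is stochastically increasing (resp. decreasing) in $p$ on an interval if for every $n\ge1$ the probability $P(T^p>n)$ is non-decreasing (resp. non-increasing) in $p$ on that interval (the usual stochastic order). *)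

theory Defs
  imports "HOL-Probability.Probability"
begin

definition walk :: "('a \<Rightarrow> int) \<Rightarrow> (nat \<Rightarrow> 'a \<Rightarrow> int) \<Rightarrow> nat \<Rightarrow> 'a \<Rightarrow> int" where
  "walk X0 X n \<omega> = X0 \<omega> + (\<Sum>k=1..n. 2 * X k \<omega>)"

text \<open>On \<^typ>\<open>enat\<close> the infimum of the empty set is \<open>\<infinity>\<close>.\<close>

definition exit_time :: "(nat \<Rightarrow> int) \<Rightarrow> (nat \<Rightarrow> 'a \<Rightarrow> int) \<Rightarrow> 'a \<Rightarrow> enat" where
  "exit_time b V \<omega> = Inf (enat ` {n. n \<ge> 1 \<and> \<bar>V n \<omega>\<bar> \<ge> b n})"

definition stoch_increasing_on :: "'a measure \<Rightarrow> (real \<Rightarrow> 'a \<Rightarrow> enat) \<Rightarrow> real set \<Rightarrow> bool" where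
  "stoch_increasing_on M T I \<longleftrightarrow>
     (\<forall>n::nat\<ge>1. mono_on I (\<lambda>p. \<P>(\<omega> in M. T p \<omega> > enat n)))"

definition stoch_decreasing_on :: "'a measure \<Rightarrow> (real \<Rightarrow> 'a \<Rightarrow> enat) \<Rightarrow> real set \<Rightarrow> bool" where
  "stoch_decreasing_on M T I \<longleftrightarrow>
     (\<forall>n::nat\<ge>1. antimono_on I (\<lambda>p. \<P>(\<omega> in M. T p \<omega> > enat n)))"

text \<open>
  The steps are \<open>X p n\<close> for \<open>n \<ge> 1\<close>. Being identically distributed is subsumed by the
  prescribed two-point law. The unused slot \<open>0\<close> is filled with \<open>X0\<close>, so that mutual independence
  of \<open>X0, X p 1, X p 2, \<dots>\<close> (independent steps, and a start independent of them) is
  a single statement. Nothing is assumed about the joint law for different \<open>p\<close>.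
\<close>

definition walk_data :: "'a measure \<Rightarrow> ('a \<Rightarrow> int) \<Rightarrow> (real \<Rightarrow> nat \<Rightarrow> 'a \<Rightarrow> int) \<Rightarrow> bool" where
  "walk_data M X0 X \<longleftrightarrow>
     prob_space M \<and>
     (\<forall>\<omega>\<in>space M. X0 \<omega> \<in> {1, -1}) \<and>
     \<P>(\<omega> in M. X0 \<omega> = 1) = 1 / 2 \<and> \<P>(\<omega> in M. X0 \<omega> = -1) = 1 / 2 \<and>
     (\<forall>p\<in>{0..1}.
        (\<forall>n\<ge>1. \<P>(\<omega> in M. X p n \<omega> = 1) = p \<and> \<P>(\<omega> in M. X p n \<omega> = -1) = 1 - p) \<and>
        prob_space.indep_vars M (\<lambda>_. count_space UNIV) ((X p)(0 := X0)) UNIV)"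

end

theory Submission
  imports Defs
begin

text \<open>
  Write \<open>V = 2 * Y + 1\<close>, so that \<open>Y\<close> is a nearest-neighbour walk on the integers started at \<open>0\<close> or
  \<open>- 1\<close> with equal probability. The map \<open>y \<mapsto> - 1 - y\<close> is the sign change of \<open>V\<close>: it leaves \<open>\<bar>V\<bar>\<close>
  alone and swaps \<open>p\<close> with \<open>q = 1 - p\<close>. For questions about \<open>\<bar>V\<bar>\<close> one may therefore start at \<open>Y = 0\<close> and
  toss one fair coin that decides whether all steps have bias \<open>p\<close> or all have bias \<open>q\<close>.

  A path from \<open>0\<close> to \<open>y\<close> has likelihoods in the ratio \<open>p ^ y : q ^ y\<close> under the two biases, whatever
  route it took. Updating the coin by this posterior shows that the mixture is again a Markov
  chain: from \<open>y\<close> it steps away from \<open>0\<close> with probability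
  \<open>g \<bar>y\<bar>\<close>, where \<open>g j = (p ^ (j + 1) + q ^ (j + 1)) / (p ^ j + q ^ j)\<close> (\<open>mixture_survival\<close>).
  The recurrence \<open>g 0 = 1 / 2\<close>, \<open>g (j + 1) = 1 - p * q / g j\<close> shows at once that \<open>g\<close>
  depends on \<open>p\<close> only through \<open>a = p * q\<close>, increases with \<open>j\<close>, and decreases with \<open>a\<close>. So the whole
  statement reduces to monotonicity in \<open>a\<close>, and the two halves of the theorem are the two
  branches of \<open>p * (1 - p)\<close>.

  It remains to see that stronger outward drift makes \<open>\<bar>V\<bar> = \<bar>2 * Y + 1\<bar>\<close> larger. Two such chains \<open>y\<close> and
  \<open>z\<close>, moved together, keep the same parity. Among positions of equal parity,
  \<open>\<bar>2 * y + 1\<bar> \<le> \<bar>2 * z + 1\<bar>\<close> implies \<open>\<bar>y\<bar> \<le> \<bar>z\<bar>\<close>, hence \<open>z\<close> also has the larger outward probability, and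
  the order of the two distances survives a monotone coupling of the next step. By induction on the
  number of steps (\<open>survival_radial_mono\<close>) the chain with the smaller \<open>a\<close> is at most as
  likely to stay inside the boundary.
\<close>

section \<open>Survival probabilities of nearest-neighbour chains\<close>

text \<open>
  \<open>survival u A m k y\<close> is the probability that a chain at \<open>y\<close> at time \<open>k\<close>, stepping up from
  \<open>x\<close> with probability \<open>u x\<close> and down otherwise, lies in \<open>A j\<close> at each of the times
  \<open>j = k + 1, \<dots>, k + m\<close>. The position at time \<open>k\<close> itself is not tested, matching an exit time
  that starts counting at \<open>1\<close>.
\<close>

primrec survival :: "(int \<Rightarrow> real) \<Rightarrow> (nat \<Rightarrow> int set) \<Rightarrow> nat \<Rightarrow> nat \<Rightarrow> int \<Rightarrow> real" where
  "survival u A 0 k y = 1"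
| "survival u A (Suc m) k y =
     u y * (of_bool (y + 1 \<in> A (Suc k)) * survival u A m (Suc k) (y + 1)) +
     (1 - u y) * (of_bool (y - 1 \<in> A (Suc k)) * survival u A m (Suc k) (y - 1))"

lemma survival_nonneg:
  assumes "\<And>y. 0 \<le> u y \<and> u y \<le> 1"
  shows "0 \<le> survival u A m k y"
  using assms by (induction m arbitrary: k y) (simp_all add: add_nonneg_nonneg)

text \<open>In terms of \<open>V = 2 * Y + 1\<close>, this is invariance under the sign change of \<open>V\<close>.\<close>

lemma survival_reflect:
  assumes "\<And>k y. - 1 - y \<in> A k \<longleftrightarrow> y \<in> A k"
  shows "survival (\<lambda>_. p) A m k (- 1 - y) = survival (\<lambda>_. 1 - p) A m k y"
proof (induction m arbitrary: k y)
  case (Suc m)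
  have up: "- 1 - y + 1 = - 1 - (y - 1)" and down: "- 1 - y - 1 = - 1 - (y + 1)"
    by simp_all
  show ?case
    unfolding survival.simps up down by (simp only: Suc assms) simp
qed simp

section \<open>The outward drift of the symmetrised walk\<close>

text \<open>
  For \<open>a = p * (1 - p)\<close> these are the ratios of consecutive power sums
  \<open>p ^ j + (1 - p) ^ j\<close>, see \<open>outward_power_sum\<close>. The recursive form is chosen because it makes the
  dependence on \<open>a\<close> alone and both monotonicity properties evident.
\<close>

primrec outward :: "real \<Rightarrow> nat \<Rightarrow> real" where
  "outward a 0 = 1 / 2"
| "outward a (Suc j) = 1 - a / outward a j"

lemma outward_bounds:
  assumes "0 \<le> a" "a \<le> 1 / 4"
  shows "1 / 2 \<le> outward a j \<and> outward a j \<le> 1"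
proof (induction j)
  case (Suc j)
  then have "a / outward a j \<le> (1 / 4) / (1 / 2)"
    using assms by (intro frac_le) auto
  moreover have "0 \<le> a / outward a j"
    using Suc assms by simp
  ultimately show ?case by simp
qed simp

lemma outward_mono:
  assumes "0 \<le> a" "a \<le> 1 / 4" "i \<le> j"
  shows "outward a i \<le> outward a j"
proof -
  have step: "outward a j \<le> outward a (Suc j)" for j
  proof (induction j)
    case 0
    then show ?case using assms by simp
  next
    case (Suc j)
    have "a / outward a (Suc j) \<le> a / outward a j"
      using assms outward_bounds[of a j] Suc by (intro divide_left_mono) auto
    then show ?case by simp
  qed
  show ?thesis
    using step assms(3) by (rule lift_Suc_mono_le)
qed

lemma outward_antimono:
  assumes "0 \<le> a" "a \<le> a'" "a' \<le> 1 / 4"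
  shows "outward a' j \<le> outward a j"
proof (induction j)
  case (Suc j)
  have "a / outward a j \<le> a' / outward a' j"
    using assms outward_bounds[of a' j] Suc by (intro frac_le) auto
  then show ?case by simp
qed simp

text \<open>
  Since \<open>p\<close> and \<open>1 - p\<close> are the roots of \<open>t\<^sup>2 = t - a\<close> with \<open>a = p * (1 - p)\<close>, their power sums satisfy
  \<open>w (j + 2) = w (j + 1) - a * w j\<close>. Dividing by \<open>w (j + 1)\<close> gives the recursion of \<open>outward\<close>.
\<close>

lemma outward_power_sum:
  fixes p :: real
  assumes "0 \<le> p" "p \<le> 1"
  shows "p ^ Suc j + (1 - p) ^ Suc j = outward (p * (1 - p)) j * (p ^ j + (1 - p) ^ j)"
proof (induction j)
  case (Suc j)
  let ?a = "p * (1 - p)" and ?w = "\<lambda>j. p ^ j + (1 - p) ^ j"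
  have "?a \<le> 1 / 4"
    using zero_le_power2[of "p - 1 / 2"] by (simp add: power2_eq_square field_simps)
  then have "outward ?a j > 0"
    using outward_bounds[of ?a j] assms by auto
  then have "?w j = ?w (Suc j) / outward ?a j"
    using Suc by (simp add: less_imp_neq[THEN not_sym] del: power_Suc)
  moreover have "?w (Suc (Suc j)) = ?w (Suc j) - ?a * ?w j"
    by (simp add: algebra_simps)
  ultimately have "?w (Suc (Suc j)) = ?w (Suc j) - ?a * (?w (Suc j) / outward ?a j)"
    by presburger
  then show ?case
    by (simp only: outward.simps left_diff_distrib mult_1_left times_divide_eq_left times_divide_eq_right)
qed simp

text \<open>
  The upward probability of a chain that moves away from \<open>0\<close> with probability \<open>g \<bar>y\<bar>\<close>. At \<open>0\<close> every step
  leads away; there the value \<open>g 0\<close> is read as the probability of going up.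
\<close>

definition radial :: "(nat \<Rightarrow> real) \<Rightarrow> int \<Rightarrow> real" where
  "radial g y = (if y \<ge> 0 then g (nat y) else 1 - g (nat (- y)))"

text \<open>
  After reaching \<open>j\<close> (respectively \<open>- j\<close>) from \<open>0\<close>, the posterior weights of the biases \<open>p\<close> and \<open>q\<close> are
  proportional to \<open>p ^ j\<close> and \<open>q ^ j\<close> (respectively \<open>q ^ j\<close> and \<open>p ^ j\<close>). The identity says that
  averaging with these weights gives the chain with outward probabilities \<open>outward (p * q)\<close>. A step
  outward raises both exponents by one; a step inward multiplies both weights by \<open>p * q\<close> and
  lowers the exponents by one. The two signs have to be treated together because a
  step from \<open>0\<close> can lead to either side.
\<close>

lemma mixture_survival:
  fixes p :: real and A :: "nat \<Rightarrow> int set"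
  assumes p: "0 \<le> p" "p \<le> 1"
  defines "q \<equiv> 1 - p"
  defines "S \<equiv> \<lambda>r. survival (\<lambda>_. r) A"
    and "U \<equiv> survival (radial (outward (p * q))) A"
  shows "p ^ j * S p m k (int j) + q ^ j * S q m k (int j) = (p ^ j + q ^ j) * U m k (int j) \<and>
    q ^ j * S p m k (- int j) + p ^ j * S q m k (- int j) = (p ^ j + q ^ j) * U m k (- int j)"
proof (induction m arbitrary: k j)
  case 0
  then show ?case by (simp add: S_def U_def)
next
  case (Suc m)
  define g where "g = outward (p * q)"
  define I where "I y = (of_bool (y \<in> A (Suc k)) :: real)" for y
  have g0: "g 0 = 1 / 2" by (simp add: g_def)
  have pq: "p + q = 1" by (simp add: q_def)
  have up: "p ^ Suc j + q ^ Suc j = g j * (p ^ j + q ^ j)" for j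
    unfolding g_def q_def by (rule outward_power_sum[OF p])
  have down: "p * q * (p ^ j + q ^ j) = (1 - g (Suc j)) * (p ^ Suc j + q ^ Suc j)" for j
  proof -
    have "p * q * (p ^ j + q ^ j) = (p ^ Suc j + q ^ Suc j) - (p ^ Suc (Suc j) + q ^ Suc (Suc j))"
      by (simp add: q_def algebra_simps)
    also have "\<dots> = (1 - g (Suc j)) * (p ^ Suc j + q ^ Suc j)"
      unfolding up[of "Suc j"] by algebra
    finally show ?thesis .
  qed
  have S: "S r (Suc m) k y = r * (I (y + 1) * S r m (Suc k) (y + 1)) +
      (1 - r) * (I (y - 1) * S r m (Suc k) (y - 1))" for r y
    by (simp add: S_def I_def)
  have U: "U (Suc m) k y = radial g y * (I (y + 1) * U m (Suc k) (y + 1)) +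
      (1 - radial g y) * (I (y - 1) * U m (Suc k) (y - 1))" for y
    by (simp add: U_def I_def g_def)
  have IH1: "p ^ j * S p m (Suc k) (int j) + q ^ j * S q m (Suc k) (int j) =
      (p ^ j + q ^ j) * U m (Suc k) (int j)"
    and IH2: "q ^ j * S p m (Suc k) (- int j) + p ^ j * S q m (Suc k) (- int j) =
      (p ^ j + q ^ j) * U m (Suc k) (- int j)" for j
    using Suc by auto
  have q1: "1 - q = p" "1 - p = q" by (simp_all add: q_def)
  show ?case
  proof (cases j)
    case 0
    have "S p (Suc m) k 0 + S q (Suc m) k 0 =
        I 1 * (p * S p m (Suc k) 1 + q * S q m (Suc k) 1) +
        I (- 1) * (q * S p m (Suc k) (- 1) + p * S q m (Suc k) (- 1))"
      by (simp add: S q1 algebra_simps)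
    also have "\<dots> = I 1 * U m (Suc k) 1 + I (- 1) * U m (Suc k) (- 1)"
      using IH1[of 1] IH2[of 1] pq by simp
    also have "\<dots> = 2 * U (Suc m) k 0"
      by (simp add: U radial_def g0)
    finally show ?thesis using 0 by simp
  next
    case (Suc i)
    have ij: "int j + 1 = int (Suc j)" "int j - 1 = int i" "- int j - 1 = - int (Suc j)"
      "- int j + 1 = - int i" using Suc by auto
    have r: "radial g (int j) = g j" "radial g (- int j) = 1 - g j"
      using Suc by (simp_all add: radial_def del: of_nat_Suc)
    have down': "p * q * (p ^ i + q ^ i) = (1 - g j) * (p ^ j + q ^ j)"
      using down[of i] Suc by simp
    have "p ^ j * S p (Suc m) k (int j) + q ^ j * S q (Suc m) k (int j) =
        I (int (Suc j)) * (p ^ Suc j * S p m (Suc k) (int (Suc j)) + q ^ Suc j * S q m (Suc k) (int (Suc j))) +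
        I (int i) * (p * q * (p ^ i * S p m (Suc k) (int i) + q ^ i * S q m (Suc k) (int i)))"
      unfolding S ij q1 unfolding Suc power_Suc by algebra
    also have "\<dots> = I (int (Suc j)) * (g j * (p ^ j + q ^ j) * U m (Suc k) (int (Suc j))) +
        I (int i) * ((1 - g j) * (p ^ j + q ^ j) * U m (Suc k) (int i))"
      unfolding IH1 up[symmetric] down'[symmetric] by algebra
    also have "\<dots> = (p ^ j + q ^ j) * U (Suc m) k (int j)"
      unfolding U ij r by algebra
    finally have 1: "p ^ j * S p (Suc m) k (int j) + q ^ j * S q (Suc m) k (int j) =
      (p ^ j + q ^ j) * U (Suc m) k (int j)" .
    have "q ^ j * S p (Suc m) k (- int j) + p ^ j * S q (Suc m) k (- int j) =
        I (- int (Suc j)) * (q ^ Suc j * S p m (Suc k) (- int (Suc j)) + p ^ Suc j * S q m (Suc k) (- int (Suc j))) +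
        I (- int i) * (p * q * (q ^ i * S p m (Suc k) (- int i) + p ^ i * S q m (Suc k) (- int i)))"
      unfolding S ij q1 unfolding Suc power_Suc by algebra
    also have "\<dots> = I (- int (Suc j)) * (g j * (p ^ j + q ^ j) * U m (Suc k) (- int (Suc j))) +
        I (- int i) * ((1 - g j) * (p ^ j + q ^ j) * U m (Suc k) (- int i))"
      unfolding IH2 up[symmetric] down'[symmetric] by algebra
    also have "\<dots> = (p ^ j + q ^ j) * U (Suc m) k (- int j)"
      unfolding U ij r by algebra
    finally show ?thesis using 1 by simp
  qed
qed

section \<open>Comparison of two radial chains\<close>

text \<open>
  The monotone coupling of two coins: with probability \<open>\<alpha>\<close> both chains step outward, with probability
  \<open>\<beta> - \<alpha>\<close> only the second one does, and with probability \<open>1 - \<beta>\<close> both step inward. The three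
  inequalities compare the outcomes in these three cases.
\<close>

lemma two_point_mono:
  fixes \<alpha> \<beta> :: real
  assumes "0 \<le> \<alpha>" "\<alpha> \<le> \<beta>" "\<beta> \<le> 1" "o' \<le> o1" "o' \<le> i1" "i' \<le> i1"
  shows "\<beta> * o' + (1 - \<beta>) * i' \<le> \<alpha> * o1 + (1 - \<alpha>) * i1"
proof -
  have "\<beta> * o' + (1 - \<beta>) * i' = \<alpha> * o' + (\<beta> - \<alpha>) * o' + (1 - \<beta>) * i'"
    by (simp add: algebra_simps)
  also have "\<dots> \<le> \<alpha> * o1 + (\<beta> - \<alpha>) * i1 + (1 - \<beta>) * i1"
    using assms by (intro add_mono mult_left_mono) auto
  also have "\<dots> = \<alpha> * o1 + (1 - \<alpha>) * i1"
    by (simp add: algebra_simps)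
  finally show ?thesis .
qed

text \<open>
  Outward and inward are meant with respect to the distance \<open>\<bar>2 * y + 1\<bar>\<close>. At \<open>0\<close>, where both steps
  increase \<open>\<bar>y\<bar>\<close>, the step to \<open>- 1\<close> counts as inward: it keeps \<open>\<bar>2 * y + 1\<bar> = 1\<close>.
\<close>

definition outer :: "int \<Rightarrow> int" where "outer y = (if y \<ge> 0 then y + 1 else y - 1)"
definition inner :: "int \<Rightarrow> int" where "inner y = (if y \<ge> 0 then y - 1 else y + 1)"

lemma survival_radial_Suc:
  "survival (radial g) A (Suc m) k y =
     g (nat \<bar>y\<bar>) * (of_bool (outer y \<in> A (Suc k)) * survival (radial g) A m (Suc k) (outer y)) +
     (1 - g (nat \<bar>y\<bar>)) * (of_bool (inner y \<in> A (Suc k)) * survival (radial g) A m (Suc k) (inner y))"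
  by (simp add: radial_def outer_def inner_def)

text \<open>
  The parity hypothesis is essential: \<open>\<bar>2 * y + 1\<bar>\<close> takes the same value at \<open>y = c - 1\<close> and \<open>y = - c\<close>, where
  \<open>\<bar>y\<bar>\<close> and therefore the drifts differ, but these two positions have opposite parity.
\<close>

lemma survival_radial_mono:
  assumes g: "\<And>i. 0 \<le> g i" "\<And>i. h i \<le> 1"
    and gh: "\<And>i j. i \<le> j \<Longrightarrow> g i \<le> h j"
    and A: "\<And>k y z. \<bar>2 * y + 1\<bar> \<le> \<bar>2 * z + 1\<bar> \<Longrightarrow> z \<in> A k \<Longrightarrow> y \<in> A k"
    and yz: "\<bar>2 * y + 1\<bar> \<le> \<bar>2 * z + 1\<bar>" "even (y - z)"
  shows "survival (radial h) A m k z \<le> survival (radial g) A m k y"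
  using yz
proof (induction m arbitrary: k y z)
  case 0
  then show ?case by simp
next
  case (Suc m)
  have bounds: "0 \<le> g i \<and> g i \<le> 1" for i
    using g[of i] gh[of i i] by (meson order_refl order_trans)
  have nonneg: "0 \<le> survival (radial g) A m (Suc k) y" for y
    by (rule survival_nonneg) (simp add: radial_def bounds)
  let ?V = "\<lambda>g y. of_bool (y \<in> A (Suc k)) * survival (radial g) A m (Suc k) y"
  have IH: "?V h z' \<le> ?V g y'" if "\<bar>2 * y' + 1\<bar> \<le> \<bar>2 * z' + 1\<bar>" "even (y' - z')" for y' z'
    using Suc.IH[OF that, of "Suc k"] A[OF that(1), of "Suc k"] nonneg by auto
  \<comment> \<open>Here parity enters: without it \<open>y = - 2\<close>, \<open>z = 1\<close> would be allowed.\<close>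
  obtain c where c: "y = z + 2 * c"
  proof
    show "y = z + 2 * ((y - z) div 2)" using Suc.prems(2) by simp
  qed
  have "\<bar>y\<bar> \<le> \<bar>z\<bar>"
    using Suc.prems(1) unfolding c abs_if by (simp split: if_splits) presburger?
  then have abs_le: "nat \<bar>y\<bar> \<le> nat \<bar>z\<bar>"
    by simp
  have out_out: "\<bar>2 * outer y + 1\<bar> \<le> \<bar>2 * outer z + 1\<bar>"
    and in_out: "\<bar>2 * inner y + 1\<bar> \<le> \<bar>2 * outer z + 1\<bar>"
    and in_in: "\<bar>2 * inner y + 1\<bar> \<le> \<bar>2 * inner z + 1\<bar>"
    using Suc.prems(1) by (auto simp: outer_def inner_def abs_if split: if_splits) presburger
  have parity: "even (outer y - outer z)" "even (inner y - outer z)" "even (inner y - inner z)"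
    using Suc.prems(2) by (auto simp: outer_def inner_def)
  show ?case
    unfolding survival_radial_Suc
    by (rule two_point_mono[OF g(1) gh[OF abs_le] g(2) IH[OF out_out parity(1)]
          IH[OF in_out parity(2)] IH[OF in_in parity(3)]])
qed


section \<open>From the probability space to survival probabilities\<close>

lemma walk_Suc: "walk X0 X (Suc n) \<omega> = walk X0 X n \<omega> + 2 * X (Suc n) \<omega>"
  by (simp add: walk_def)

text \<open>
  The integers carry the discrete \<open>\<sigma>\<close>-algebra here, so measurability of a sum comes from
  the countability of the range of one summand.
\<close>

lemma walk_measurable:
  assumes X0: "X0 \<in> measurable M (count_space UNIV)"
    and X: "\<And>n. X n \<in> measurable M (count_space UNIV)"
  shows "walk X0 X n \<in> measurable M (count_space UNIV)"
proof (induction n)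
  case 0
  then show ?case using X0 by (simp add: walk_def[abs_def])
next
  case (Suc n)
  have "(\<lambda>\<omega>. (\<lambda>v \<omega>. v + 2 * X (Suc n) \<omega>) (walk X0 X n \<omega>) \<omega>) \<in> measurable M (count_space UNIV)"
    by (rule measurable_compose_countable[OF _ Suc], rule measurable_compose[OF X]) simp
  then show ?case by (simp add: walk_Suc[abs_def])
qed

lemma (in prob_space) prob_split_two_values:
  assumes [measurable]: "f \<in> measurable M (count_space UNIV)" "Measurable.pred M P"
    and ab: "a \<noteq> b" and full: "\<P>(\<omega> in M. f \<omega> = a) + \<P>(\<omega> in M. f \<omega> = b) = 1"
  shows "\<P>(\<omega> in M. P \<omega>) = \<P>(\<omega> in M. f \<omega> = a \<and> P \<omega>) + \<P>(\<omega> in M. f \<omega> = b \<and> P \<omega>)"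
proof -
  have "\<P>(\<omega> in M. f \<omega> = a \<or> f \<omega> = b) = \<P>(\<omega> in M. f \<omega> = a) + \<P>(\<omega> in M. f \<omega> = b)"
    using ab by (subst finite_measure_Union[symmetric]) (auto intro!: arg_cong[where f = prob])
  then have "AE \<omega> in M. f \<omega> = a \<or> f \<omega> = b"
    using full by (subst prob_Collect_eq_1[symmetric]) auto
  then have "\<P>(\<omega> in M. P \<omega>) = \<P>(\<omega> in M. f \<omega> = a \<and> P \<omega> \<or> f \<omega> = b \<and> P \<omega>)"
    by (intro finite_measure_eq_AE) auto
  also have "\<dots> = \<P>(\<omega> in M. f \<omega> = a \<and> P \<omega>) + \<P>(\<omega> in M. f \<omega> = b \<and> P \<omega>)"
    using ab by (subst finite_measure_Union[symmetric]) (auto intro!: arg_cong[where f = prob])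
  finally show ?thesis .
qed

text \<open>
  The Markov property in elementary form. Conditioning only on complete prefixes \<open>x 0, \<dots>, x k\<close> keeps
  the use of independence down to the product formula for cylinders: in the induction on the number
  of remaining steps, the next step merely lengthens the prefix. The prefix enters the right-hand
  side only through its probability and the position \<open>y\<close> to which it leads.
\<close>

lemma (in prob_space) prob_cylinder_survival:
  fixes Z :: "nat \<Rightarrow> 'a \<Rightarrow> int"
  assumes indep: "indep_vars (\<lambda>_. count_space UNIV) Z UNIV"
    and law: "\<And>n. n \<ge> 1 \<Longrightarrow> \<P>(\<omega> in M. Z n \<omega> = 1) = p \<and> \<P>(\<omega> in M. Z n \<omega> = - 1) = 1 - p"
    and y: "x 0 + (\<Sum>i=1..k. 2 * x i) = 2 * y + 1"
  shows "\<P>(\<omega> in M. (\<forall>i\<le>k. Z i \<omega> = x i) \<and>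
      (\<forall>j\<in>{k<..k + m}. (walk (Z 0) Z j \<omega> - 1) div 2 \<in> A j)) =
    \<P>(\<omega> in M. \<forall>i\<le>k. Z i \<omega> = x i) * survival (\<lambda>_. p) A m k y"
  using y
proof (induction m arbitrary: k x y)
  case 0
  then show ?case by simp
next
  case (Suc m)
  have Z[measurable]: "Z n \<in> measurable M (count_space UNIV)" for n
    using indep by (auto simp: indep_vars_def)
  have [measurable]: "walk (Z 0) Z n \<in> measurable M (count_space UNIV)" for n
    by (intro walk_measurable Z)
  let ?E = "\<lambda>\<omega>. (\<forall>i\<le>k. Z i \<omega> = x i) \<and>
      (\<forall>j\<in>{k<..k + Suc m}. (walk (Z 0) Z j \<omega> - 1) div 2 \<in> A j)"
  let ?C = "\<P>(\<omega> in M. \<forall>i\<le>k. Z i \<omega> = x i)"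
  have cylinder: "\<P>(\<omega> in M. \<forall>i\<le>k. Z i \<omega> = x i) = (\<Prod>i\<le>k. \<P>(\<omega> in M. Z i \<omega> = x i))" for k x
  proof -
    have "prob (\<Inter>i\<in>{..k}. Z i -` {x i} \<inter> space M) = (\<Prod>i\<le>k. prob (Z i -` {x i} \<inter> space M))"
      using indep by (intro indep_varsD[where I = UNIV]) auto
    moreover have "(\<Inter>i\<in>{..k}. Z i -` {x i} \<inter> space M) = {\<omega> \<in> space M. \<forall>i\<le>k. Z i \<omega> = x i}"
      by auto
    moreover have "Z i -` {x i} \<inter> space M = {\<omega> \<in> space M. Z i \<omega> = x i}" for i
      by auto
    ultimately show ?thesis by simp
  qed
  have law_Suc: "\<P>(\<omega> in M. Z (Suc k) \<omega> = 1) = p" "\<P>(\<omega> in M. Z (Suc k) \<omega> = - 1) = 1 - p"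
    using law[of "Suc k"] by auto
  have branch: "\<P>(\<omega> in M. Z (Suc k) \<omega> = s \<and> ?E \<omega>) =
      ?C * (\<P>(\<omega> in M. Z (Suc k) \<omega> = s) *
        (of_bool (y + s \<in> A (Suc k)) * survival (\<lambda>_. p) A m (Suc k) (y + s)))" for s
  proof -
    define x' where "x' = x(Suc k := s)"
    have x': "x' i = x i" if "i \<le> k" for i using that by (simp add: x'_def)
    have sum': "x' 0 + (\<Sum>i=1..k. 2 * x' i) = 2 * y + 1"
      using Suc.prems by (simp add: x')
    have pos: "(walk (Z 0) Z (Suc k) \<omega> - 1) div 2 = y + s" if "\<forall>i\<le>Suc k. Z i \<omega> = x' i" for \<omega>
    proof -
      have "walk (Z 0) Z (Suc k) \<omega> = x' 0 + (\<Sum>i=1..Suc k. 2 * x' i)"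
        using that by (simp add: walk_def)
      also have "\<dots> = 2 * (y + s) + 1"
        using sum' by (simp add: x'_def)
      finally show ?thesis by simp
    qed
    have "{\<omega> \<in> space M. Z (Suc k) \<omega> = s \<and> ?E \<omega>} = {\<omega> \<in> space M. y + s \<in> A (Suc k) \<and>
        (\<forall>i\<le>Suc k. Z i \<omega> = x' i) \<and>
        (\<forall>j\<in>{Suc k<..Suc k + m}. (walk (Z 0) Z j \<omega> - 1) div 2 \<in> A j)}"
    proof (rule Collect_cong)
      fix \<omega>
      have 1: "Z (Suc k) \<omega> = s \<and> (\<forall>i\<le>k. Z i \<omega> = x i) \<longleftrightarrow> (\<forall>i\<le>Suc k. Z i \<omega> = x' i)"
        unfolding le_Suc_eq by (simp add: x'_def) (metis Suc_n_not_le_n)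
      have 2: "{k<..k + Suc m} = insert (Suc k) {Suc k<..Suc k + m}" by auto
      show "(\<omega> \<in> space M \<and> Z (Suc k) \<omega> = s \<and> ?E \<omega>) = (\<omega> \<in> space M \<and> y + s \<in> A (Suc k) \<and>
        (\<forall>i\<le>Suc k. Z i \<omega> = x' i) \<and>
        (\<forall>j\<in>{Suc k<..Suc k + m}. (walk (Z 0) Z j \<omega> - 1) div 2 \<in> A j))"
        unfolding 2 using 1 pos[of \<omega>] by auto
    qed
    then have "\<P>(\<omega> in M. Z (Suc k) \<omega> = s \<and> ?E \<omega>) = of_bool (y + s \<in> A (Suc k)) *
        \<P>(\<omega> in M. (\<forall>i\<le>Suc k. Z i \<omega> = x' i) \<and>
        (\<forall>j\<in>{Suc k<..Suc k + m}. (walk (Z 0) Z j \<omega> - 1) div 2 \<in> A j))"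
      by simp
    also have "\<dots> = of_bool (y + s \<in> A (Suc k)) *
        (\<P>(\<omega> in M. \<forall>i\<le>Suc k. Z i \<omega> = x' i) * survival (\<lambda>_. p) A m (Suc k) (y + s))"
      using sum' by (subst Suc.IH[of x' "Suc k" "y + s"]) (simp_all add: x'_def)
    also have "\<P>(\<omega> in M. \<forall>i\<le>Suc k. Z i \<omega> = x' i) = ?C * \<P>(\<omega> in M. Z (Suc k) \<omega> = s)"
      unfolding cylinder by (simp add: x' cong: prod.cong) (simp add: x'_def)
    finally show ?thesis by (simp add: mult_ac)
  qed
  have "\<P>(\<omega> in M. ?E \<omega>) =
      \<P>(\<omega> in M. Z (Suc k) \<omega> = 1 \<and> ?E \<omega>) + \<P>(\<omega> in M. Z (Suc k) \<omega> = - 1 \<and> ?E \<omega>)"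
    using law_Suc by (intro prob_split_two_values) auto
  also have "\<dots> = ?C * survival (\<lambda>_. p) A (Suc m) k y"
    unfolding branch law_Suc by (simp add: distrib_left)
  finally show ?case .
qed

lemma less_exit_time_iff:
  "enat n < exit_time b V \<omega> \<longleftrightarrow> (\<forall>j\<in>{0<..n}. \<bar>V j \<omega>\<bar> < b j)"
proof
  assume L: "enat n < exit_time b V \<omega>"
  show "\<forall>j\<in>{0<..n}. \<bar>V j \<omega>\<bar> < b j"
  proof (intro ballI, rule ccontr)
    fix j assume "j \<in> {0<..n}" "\<not> \<bar>V j \<omega>\<bar> < b j"
    then have "exit_time b V \<omega> \<le> enat j" "enat j \<le> enat n"
      unfolding exit_time_def by (auto intro!: Inf_lower)
    then have "exit_time b V \<omega> \<le> enat n" by (rule order_trans)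
    with L show False by simp
  qed
next
  assume R: "\<forall>j\<in>{0<..n}. \<bar>V j \<omega>\<bar> < b j"
  have "enat (Suc n) \<le> exit_time b V \<omega>"
    unfolding exit_time_def
  proof (rule Inf_greatest)
    fix t assume "t \<in> enat ` {n. n \<ge> 1 \<and> \<bar>V n \<omega>\<bar> \<ge> b n}"
    then obtain j where j: "t = enat j" "j \<ge> 1" "\<not> \<bar>V j \<omega>\<bar> < b j" by auto
    with R have "\<not> j \<le> n" by auto
    with j(1) show "enat (Suc n) \<le> t" by simp
  qed
  then show "enat n < exit_time b V \<omega>"
    by (rule less_le_trans[rotated]) simp
qed

section \<open>Monotonicity of the exit time\<close>

text \<open>
  The starts \<open>1\<close> and \<open>- 1\<close> of \<open>V\<close> correspond to the positions \<open>0\<close> and \<open>- 1\<close> of \<open>Y\<close>. Reflection turns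
  the second into a start at \<open>0\<close> with bias \<open>1 - p\<close>, which leaves the equal mixture of the two biases
  from \<open>0\<close>, the case \<open>j = 0\<close> of \<open>mixture_survival\<close>.
\<close>

lemma prob_exit_time_gt:
  assumes data: "walk_data M X0 X" and p: "0 \<le> p" "p \<le> 1"
  shows "\<P>(\<omega> in M. exit_time b (walk X0 (X p)) \<omega> > enat n) =
    survival (radial (outward (p * (1 - p)))) (\<lambda>k. {y. \<bar>2 * y + 1\<bar> < b k}) n 0 0"
proof -
  interpret prob_space M using data by (simp add: walk_data_def)
  define A where "A k = {y. \<bar>2 * y + 1\<bar> < b k}" for k
  define Z where "Z = (X p)(0 := X0)"
  have indep: "indep_vars (\<lambda>_. count_space UNIV) Z UNIV"
    and law: "\<And>n. n \<ge> 1 \<Longrightarrow> \<P>(\<omega> in M. Z n \<omega> = 1) = p \<and> \<P>(\<omega> in M. Z n \<omega> = - 1) = 1 - p"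
    and start: "\<P>(\<omega> in M. Z 0 \<omega> = 1) = 1 / 2" "\<P>(\<omega> in M. Z 0 \<omega> = - 1) = 1 / 2"
      "\<And>\<omega>. \<omega> \<in> space M \<Longrightarrow> Z 0 \<omega> = 1 \<or> Z 0 \<omega> = - 1"
    using data p by (auto simp: walk_data_def Z_def)
  have Z[measurable]: "Z n \<in> measurable M (count_space UNIV)" for n
    using indep by (auto simp: indep_vars_def)
  have [measurable]: "walk (Z 0) Z n \<in> measurable M (count_space UNIV)" for n
    by (intro walk_measurable Z)
  let ?S = "\<lambda>\<omega>. \<forall>j\<in>{0<..n}. (walk (Z 0) Z j \<omega> - 1) div 2 \<in> A j"
  have odd: "odd (walk (Z 0) Z j \<omega>)" if "\<omega> \<in> space M" for j \<omega>
    using start(3)[OF that] by (auto simp: walk_def sum_distrib_left[symmetric])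
  have walk_Z: "walk X0 (X p) = walk (Z 0) Z"
    by (intro ext) (simp add: walk_def Z_def)
  have "enat n < exit_time b (walk X0 (X p)) \<omega> \<longleftrightarrow> ?S \<omega>" if "\<omega> \<in> space M" for \<omega>
    unfolding less_exit_time_iff walk_Z A_def using odd[OF that] by simp
  then have "\<P>(\<omega> in M. exit_time b (walk X0 (X p)) \<omega> > enat n) = \<P>(\<omega> in M. ?S \<omega>)"
    by (intro arg_cong[where f = prob]) auto
  also have "\<dots> = \<P>(\<omega> in M. Z 0 \<omega> = 1 \<and> ?S \<omega>) + \<P>(\<omega> in M. Z 0 \<omega> = - 1 \<and> ?S \<omega>)"
    using start by (intro prob_split_two_values) auto
  also have "\<dots> = (survival (\<lambda>_. p) A n 0 0 + survival (\<lambda>_. p) A n 0 (- 1)) / 2"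
    using prob_cylinder_survival[OF indep law, where x = "\<lambda>_. 1" and k = 0 and m = n and y = 0 and A = A]
      prob_cylinder_survival[OF indep law, where x = "\<lambda>_. - 1" and k = 0 and m = n and y = "- 1" and A = A]
      start by simp
  also have "survival (\<lambda>_. p) A n 0 (- 1) = survival (\<lambda>_. 1 - p) A n 0 0"
  proof -
    have "- 1 - y \<in> A k \<longleftrightarrow> y \<in> A k" for k y by (auto simp: A_def)
    from survival_reflect[of A p n 0 0, OF this] show ?thesis by simp
  qed
  also have "(survival (\<lambda>_. p) A n 0 0 + survival (\<lambda>_. 1 - p) A n 0 0) / 2 =
      survival (radial (outward (p * (1 - p)))) A n 0 0"
    using mixture_survival[OF p, where j = 0 and m = n and k = 0 and A = A] by simp
  finally show ?thesis by (simp add: A_def[abs_def])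
qed

text \<open>
  Combining monotonicity of \<open>outward\<close> in the distance and in the parameter gives drifts that are
  ordered even between different positions, as \<open>survival_radial_mono\<close> requires.
\<close>

lemma prob_exit_time_gt_mono:
  assumes data: "walk_data M X0 X" and "p \<in> {0..1}" "p' \<in> {0..1}"
    and le: "p * (1 - p) \<le> p' * (1 - p')"
  shows "\<P>(\<omega> in M. exit_time b (walk X0 (X p)) \<omega> > enat n) \<le>
    \<P>(\<omega> in M. exit_time b (walk X0 (X p')) \<omega> > enat n)"
proof -
  define a a' where "a = p * (1 - p)" and "a' = p' * (1 - p')"
  have a: "0 \<le> a" "a \<le> a'"
    using assms by (simp_all add: a_def a'_def)
  have a': "a' \<le> 1 / 4"
    using zero_le_power2[of "p' - 1 / 2"] by (simp add: a'_def power2_eq_square field_simps)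
  have compare: "outward a' i \<le> outward a j" if "i \<le> j" for i j
    using outward_mono[of a' i j] outward_antimono[of a a' j] a a' that by simp
  have lower: "0 \<le> outward a' i" and upper: "outward a i \<le> 1" for i
    using outward_bounds[of a' i] outward_bounds[of a i] a a' by simp_all
  have "survival (radial (outward a)) (\<lambda>k. {y. \<bar>2 * y + 1\<bar> < b k}) n 0 0 \<le>
    survival (radial (outward a')) (\<lambda>k. {y. \<bar>2 * y + 1\<bar> < b k}) n 0 0"
    by (rule survival_radial_mono[OF lower upper compare]) auto
  then show ?thesis
    using assms by (simp add: prob_exit_time_gt[OF data] a_def a'_def)
qed

theorem corollary3:
  fixes M :: "'a measure" and X0 :: "'a \<Rightarrow> int" and X :: "real \<Rightarrow> nat \<Rightarrow> 'a \<Rightarrow> int"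
    and b :: "nat \<Rightarrow> int"
  assumes "walk_data M X0 X"
    and "\<And>n. n \<ge> 1 \<Longrightarrow> b n \<ge> 1 \<and> odd (b n)"
  shows "stoch_increasing_on M (\<lambda>p. exit_time b (walk X0 (X p))) {0..1/2} \<and>
         stoch_decreasing_on M (\<lambda>p. exit_time b (walk X0 (X p))) {1/2..1}"
proof -
  have diff: "s * (1 - s) - r * (1 - r) = (s - r) * (1 - r - s)" for r s :: real
    by algebra
  have "0 \<le> (s - r) * (1 - r - s)" if "r \<le> s" "s \<le> 1 / 2" for r s :: real
    using that by (intro mult_nonneg_nonneg) auto
  then have "r * (1 - r) \<le> s * (1 - s)" if "r \<le> s" "s \<le> 1 / 2" for r s :: real
    using diff[of s r] that by (metis diff_ge_0_iff_ge)
  moreover have "(s - r) * (1 - r - s) \<le> 0" if "1 / 2 \<le> r" "r \<le> s" for r s :: real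
    using that by (intro mult_nonneg_nonpos) auto
  then have "s * (1 - s) \<le> r * (1 - r)" if "1 / 2 \<le> r" "r \<le> s" for r s :: real
    using diff[of s r] that by (metis diff_le_0_iff_le)
  ultimately show ?thesis
    unfolding stoch_increasing_on_def stoch_decreasing_on_def monotone_on_def
    by (auto intro!: prob_exit_time_gt_mono[OF assms(1)])
qed

end
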